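(* Let $r\ge1$ and let $a_1,\dots,a_r$ be nonzero complex numbers. For every integer $n\ge1$, \begin{align*} D_n(x|a_1,\dots,a_r)&=xD_{n-1}(x-1|a_1,\dots,a_r)+\frac{r}{n}\sum_{l=0}^n\binom{n}{l}c_lD_{n-l}(x-1|a_1,\dots,a_r)\\ &\quad-\frac1n\sum_{j=1}^r\sum_{l=0}^n\binom{n}{l}a_jc_lD_{n-l}(x+a_j-1|a_1,\dots,a_r,a_j), \end{align*} \begin{align*} \widehat D_n(x|a_1,\dots,a_r)&=\Big(x+\sum_{j=1}^ra_j\Big)\widehat D_{n-1}(x-1|a_1,\dots,a_r)+\frac{r}{n}\sum_{l=0}^n\binom{n}{l}c_l\widehat D_{n-l}(x-1|a_1,\dots,a_r)\\ &\quad-\frac1n\sum_{j=1}^r\sum_{l=0}^n\binom{n}{l}a_jc_l\widehat D_{n-l}(x-1|a_1,\dots,a_r,a_j). \end{align*}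
   Context: For any $k\ge1$ and nonzero complex $b_1,\dots,b_k$, the Barnes-type Daehee polynomials of the first and second kind are defined by the formal power series identities $\prod_{j=1}^k\frac{\ln(1+t)}{(1+t)^{b_j}-1}(1+t)^x=\sum_{n\ge0}D_n(x|b_1,\dots,b_k)\frac{t^n}{n!}$ and $\prod_{j=1}^k\frac{(1+t)^{b_j}\ln(1+t)}{(1+t)^{b_j}-1}(1+t)^x=\sum_{n\ge0}\widehat D_n(x|b_1,\dots,b_k)\frac{t^n}{n!}$. In the claim, $(a_1,\dots,a_r,a_j)$ denotes the list of $r+1$ parameters obtained by appending $a_j$ once more. The Cauchy numbers $c_n$ are defined by $\frac{t}{\ln(1+t)}=\sum_{n\ge0}c_n\frac{t^n}{n!}$. *)

theory Defs
  imports Complex_Main "HOL-Computational_Algebra.Formal_Power_Series"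
begin

(* Generating functions live in complex fps: the series ln (1 + t) is fps_ln 1 and
   (1 + t)^b, for complex b, is fps_binomial b.  The parameter list is 0-indexed. *)

definition daehee_gf :: "complex \<Rightarrow> complex list \<Rightarrow> complex fps" where
  "daehee_gf x bs =
     (\<Prod>b\<leftarrow>bs. fps_ln 1 / (fps_binomial b - 1)) * fps_binomial x"

definition daehee_hat_gf :: "complex \<Rightarrow> complex list \<Rightarrow> complex fps" where
  "daehee_hat_gf x bs =
     (\<Prod>b\<leftarrow>bs. (fps_binomial b * fps_ln 1) / (fps_binomial b - 1)) * fps_binomial x"

definition daehee :: "nat \<Rightarrow> complex \<Rightarrow> complex list \<Rightarrow> complex" where
  "daehee n x bs = fact n * fps_nth (daehee_gf x bs) n"

definition daehee_hat :: "nat \<Rightarrow> complex \<Rightarrow> complex list \<Rightarrow> complex" where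
  "daehee_hat n x bs = fact n * fps_nth (daehee_hat_gf x bs) n"

definition cauchy_num :: "nat \<Rightarrow> complex" where
  "cauchy_num n = fact n * fps_nth (fps_X / fps_ln 1) n"

lemma daehee_egf: "Abs_fps (\<lambda>n. daehee n x bs / fact n) = daehee_gf x bs"
  by (simp add: fps_eq_iff daehee_def)

lemma daehee_hat_egf: "Abs_fps (\<lambda>n. daehee_hat n x bs / fact n) = daehee_hat_gf x bs"
  by (simp add: fps_eq_iff daehee_hat_def)

lemma cauchy_num_egf: "Abs_fps (\<lambda>n. cauchy_num n / fact n) = fps_X / fps_ln 1"
  by (simp add: fps_eq_iff cauchy_num_def)

(* Numerators and denominators all have subdegree >= 1 and every denominator has subdegree
   exactly 1, so the fps divisions above are exact: *)

lemma subdegree_fps_ln_1: "subdegree (fps_ln (1::complex)) = 1"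
  by (rule subdegreeI) (auto simp: fps_ln_nth)

lemma subdegree_fps_binomial_minus_1:
  assumes "b \<noteq> (0::complex)"
  shows "subdegree (fps_binomial b - 1) = 1"
  using assms by (intro subdegreeI) auto

lemma daehee_factor_exact:
  assumes "b \<noteq> (0::complex)"
  shows "fps_ln 1 / (fps_binomial b - 1) * (fps_binomial b - 1) = fps_ln 1"
proof -
  have "fps_binomial b - 1 \<noteq> 0"
    using subdegree_fps_binomial_minus_1[OF assms] by auto
  then have "fps_binomial b - 1 dvd fps_ln 1"
    using subdegree_fps_binomial_minus_1[OF assms] subdegree_fps_ln_1
    by (intro fps_dvd_iff[THEN iffD2]) (auto simp: subdegree_eq_0_iff)
  then show ?thesis by simp
qed

lemma cauchy_factor_exact: "fps_X / fps_ln 1 * fps_ln 1 = (fps_X :: complex fps)"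
proof -
  have "fps_ln 1 \<noteq> (0 :: complex fps)" using subdegree_fps_ln_1 by auto
  then have "fps_ln 1 dvd (fps_X :: complex fps)"
    using subdegree_fps_ln_1 by (intro fps_dvd_iff[THEN iffD2]) auto
  then show ?thesis by simp
qed

end

(* With L = ln (1 + t), the factor q = L / ((1 + t)^b - 1) satisfies the logarithmic-derivative
   equation t q' = q (t / L) (1 + t)^(-1) (1 - b (1 + t)^b q), obtained by differentiating
   q ((1 + t)^b - 1) = L.  Multiplying over the parameter list, t G' is a combination of
   generating functions with the argument shifted by -1 (the factor (1 + t)^(-1)), convolved
   with the Cauchy series t / L; comparing coefficients of t^n gives both recurrences. *)

theory Submission
  imports Defs
begin

text \<open>Writing 1 / (1 + t) as \<open>fps_binomial (- 1)\<close> keeps everything a product of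
  powers of 1 + t, so that exponents can later be merged by
  \<open>fps_binomial_add_mult\<close>.\<close>

lemma fps_deriv_fps_binomial:
  "fps_deriv (fps_binomial c) = fps_const c * fps_binomial c * fps_binomial (- 1 :: complex)"
  by (simp add: fps_binomial_deriv fps_binomial_minus_one fps_divide_unit)

lemma fps_deriv_fps_ln_1: "fps_deriv (fps_ln 1) = fps_binomial (- 1 :: complex)"
  by (simp add: fps_ln_deriv fps_binomial_minus_one)

lemma daehee_factor_deriv:
  fixes b :: complex
  assumes "b \<noteq> 0"
  defines "q \<equiv> fps_ln 1 / (fps_binomial b - 1)"
  shows "fps_X * fps_deriv q = q * (fps_X / fps_ln 1 * fps_binomial (- 1)
           * (1 - fps_const b * fps_binomial b * q))"
proof -
  define L C B W where "L = fps_ln (1 :: complex)" and "C = fps_X / fps_ln (1 :: complex)"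
    and "B = fps_binomial b" and "W = fps_binomial (- 1 :: complex)"
  have B1: "B - 1 \<noteq> 0"
    using subdegree_fps_binomial_minus_1[OF assms(1)] by (auto simp: B_def)
  have qB: "q * (B - 1) = L"
    using daehee_factor_exact[OF assms(1)] by (simp add: q_def B_def L_def)
  have CL: "C * L = fps_X"
    using cauchy_factor_exact by (simp add: C_def L_def)
  have "fps_deriv (q * (B - 1)) = W"
    by (simp add: qB L_def W_def fps_deriv_fps_ln_1)
  then have d: "fps_deriv q * (B - 1) + q * (fps_const b * B * W) = W"
    by (simp add: B_def W_def fps_deriv_fps_binomial algebra_simps)
  \<comment> \<open>The factor B - 1 is not a unit, so both sides are multiplied by it and it is
    cancelled at the end. On the right it reappears, together with the wanted factor q, when L is
    replaced by q (B - 1).\<close>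
  have "(B - 1) * (fps_X * fps_deriv q) = C * L * (fps_deriv q * (B - 1))"
    by (simp add: CL mult_ac)
  also have "fps_deriv q * (B - 1) = W * (1 - fps_const b * B * q)"
    using d by (simp add: algebra_simps)
  also have "C * L * (W * (1 - fps_const b * B * q))
      = (B - 1) * (q * (C * W * (1 - fps_const b * B * q)))"
    by (simp only: mult_ac flip: qB)
  finally have "(B - 1) * (fps_X * fps_deriv q)
      = (B - 1) * (q * (C * W * (1 - fps_const b * B * q)))" .
  then show ?thesis
    using B1 by (simp add: C_def B_def W_def)
qed

text \<open>The factor is (1 + t)^b times the one of the first kind. The power adds b t / (1 + t) to
  the logarithmic derivative, and the product (1 + t)^b p there becomes q itself, so no shift by b
  remains.\<close>

lemma daehee_hat_factor_deriv:
  fixes b :: complex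
  assumes "b \<noteq> 0"
  defines "q \<equiv> fps_binomial b * fps_ln 1 / (fps_binomial b - 1)"
  shows "fps_X * fps_deriv q = q * (fps_const b * fps_X * fps_binomial (- 1)
           + fps_X / fps_ln 1 * fps_binomial (- 1) * (1 - fps_const b * q))"
proof -
  define p where "p = fps_ln 1 / (fps_binomial b - 1)"
  \<comment> \<open>Moving (1 + t)^b out of the quotient requires the division to be exact.\<close>
  have "fps_binomial b - 1 dvd fps_ln 1"
    using daehee_factor_exact[OF assms(1)] by (metis dvd_triv_right)
  then have q: "q = fps_binomial b * p"
    by (simp add: q_def p_def div_mult_swap)
  have "fps_X * fps_deriv q
      = fps_binomial b * (fps_X * fps_deriv p) + fps_X * (fps_deriv (fps_binomial b) * p)"
    by (simp add: q algebra_simps)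
  then show ?thesis
    unfolding daehee_factor_deriv[OF assms(1), folded p_def] fps_deriv_fps_binomial
    by (simp add: q algebra_simps)
qed

text \<open>Leibniz rule: logarithmic derivatives add up. The multiplied-out form avoids dividing by
  \<open>f b\<close>, and induction on the list lets parameters repeat.\<close>

lemma fps_deriv_prod_list_log:
  fixes f g :: "'a \<Rightarrow> 'b :: comm_ring_1 fps"
  assumes "\<And>b. b \<in> set bs \<Longrightarrow> fps_X * fps_deriv (f b) = f b * g b"
  shows "fps_X * fps_deriv (\<Prod>b\<leftarrow>bs. f b) = (\<Prod>b\<leftarrow>bs. f b) * (\<Sum>b\<leftarrow>bs. g b)"
  using assms
proof (induction bs)
  case (Cons b bs)
  define P where "P = (\<Prod>b\<leftarrow>bs. f b)"
  have IH: "fps_X * fps_deriv P = P * (\<Sum>b\<leftarrow>bs. g b)"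
    unfolding P_def using Cons by simp
  have fb: "fps_X * fps_deriv (f b) = f b * g b"
    using Cons.prems by simp
  have "fps_X * fps_deriv (f b * P) = f b * (fps_X * fps_deriv P) + fps_X * fps_deriv (f b) * P"
    by (simp add: algebra_simps)
  also have "\<dots> = f b * P * (g b + (\<Sum>b\<leftarrow>bs. g b))"
    unfolding IH fb by (simp add: algebra_simps)
  finally show ?case
    by (simp add: P_def)
qed simp

text \<open>The part shared by both kinds: differentiating (1 + t)^x yields the summand that becomes
  x times the polynomial of index n - 1 at x - 1.\<close>

lemma fps_deriv_prod_list_binomial:
  fixes f g :: "complex \<Rightarrow> complex fps"
  assumes "\<And>b. b \<in> set bs \<Longrightarrow> fps_X * fps_deriv (f b) = f b * g b"
  shows "fps_X * fps_deriv ((\<Prod>b\<leftarrow>bs. f b) * fps_binomial x)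
       = fps_const x * fps_X * ((\<Prod>b\<leftarrow>bs. f b) * fps_binomial (x - 1))
         + (\<Prod>b\<leftarrow>bs. f b) * fps_binomial x * (\<Sum>b\<leftarrow>bs. g b)"
proof -
  define P where "P = (\<Prod>b\<leftarrow>bs. f b)"
  have P: "fps_X * fps_deriv P = P * (\<Sum>b\<leftarrow>bs. g b)"
    unfolding P_def using assms by (rule fps_deriv_prod_list_log)
  have W: "fps_binomial (x - 1) = fps_binomial x * fps_binomial (- 1)"
    by (simp flip: fps_binomial_add_mult)
  have "fps_X * fps_deriv (P * fps_binomial x)
      = fps_X * fps_deriv P * fps_binomial x + P * (fps_X * fps_deriv (fps_binomial x))"
    by (simp add: algebra_simps)
  then show ?thesis
    unfolding P fps_deriv_fps_binomial W P_def[symmetric] by (simp add: algebra_simps)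
qed

lemma daehee_gf_deriv:
  assumes "\<And>b. b \<in> set bs \<Longrightarrow> b \<noteq> 0"
  shows "fps_X * fps_deriv (daehee_gf x bs)
       = fps_const x * fps_X * daehee_gf (x - 1) bs
         + of_nat (length bs) * (fps_X / fps_ln 1 * daehee_gf (x - 1) bs)
         - (\<Sum>b\<leftarrow>bs. fps_const b * (fps_X / fps_ln 1 * daehee_gf (x + b - 1) (bs @ [b])))"
proof -
  define q where "q = (\<lambda>b :: complex. fps_ln 1 / (fps_binomial b - 1))"
  define C where "C = fps_X / fps_ln (1 :: complex)"
  define P where "P = (\<Prod>b\<leftarrow>bs. q b)"
  have W: "fps_binomial (y - 1) = fps_binomial y * fps_binomial (- 1)" for y :: complex
    by (simp flip: fps_binomial_add_mult)
  have "fps_X * fps_deriv (daehee_gf x bs)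
      = fps_const x * fps_X * daehee_gf (x - 1) bs
        + P * fps_binomial x
          * (\<Sum>b\<leftarrow>bs. C * fps_binomial (- 1) * (1 - fps_const b * fps_binomial b * q b))"
    unfolding daehee_gf_def P_def q_def C_def
    by (rule fps_deriv_prod_list_binomial) (use daehee_factor_deriv assms in blast)
  \<comment> \<open>The factor \<open>P * q b\<close> is the product over \<open>bs @ [b]\<close>,
    and the exponents x, b and -1 combine to x + b - 1. The constant 1 in each bracket gives one
    copy of the Cauchy term per parameter.\<close>
  also have "P * fps_binomial x
        * (\<Sum>b\<leftarrow>bs. C * fps_binomial (- 1) * (1 - fps_const b * fps_binomial b * q b))
      = (\<Sum>b\<leftarrow>bs. C * (P * fps_binomial (x - 1))
           - fps_const b * (C * (P * q b * fps_binomial (x + b - 1))))"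
    by (simp add: W fps_binomial_add_mult algebra_simps flip: sum_list_const_mult)
  finally show ?thesis
    by (simp add: daehee_gf_def P_def q_def C_def sum_list_subtractf sum_list_triv)
qed

lemma daehee_hat_gf_deriv:
  assumes "\<And>b. b \<in> set bs \<Longrightarrow> b \<noteq> 0"
  shows "fps_X * fps_deriv (daehee_hat_gf x bs)
       = fps_const (x + sum_list bs) * fps_X * daehee_hat_gf (x - 1) bs
         + of_nat (length bs) * (fps_X / fps_ln 1 * daehee_hat_gf (x - 1) bs)
         - (\<Sum>b\<leftarrow>bs. fps_const b * (fps_X / fps_ln 1 * daehee_hat_gf (x - 1) (bs @ [b])))"
proof -
  define q where "q = (\<lambda>b :: complex. fps_binomial b * fps_ln 1 / (fps_binomial b - 1))"
  define C where "C = fps_X / fps_ln (1 :: complex)"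
  define P where "P = (\<Prod>b\<leftarrow>bs. q b)"
  have W: "fps_binomial (x - 1) = fps_binomial x * fps_binomial (- 1)"
    by (simp flip: fps_binomial_add_mult)
  have c: "(\<Sum>b\<leftarrow>bs. fps_const b * Q) = fps_const (sum_list bs) * Q" for Q :: "complex fps"
    by (induction bs) (simp_all add: algebra_simps flip: fps_const_add)
  have "fps_X * fps_deriv (daehee_hat_gf x bs)
      = fps_const x * fps_X * daehee_hat_gf (x - 1) bs
        + P * fps_binomial x
          * (\<Sum>b\<leftarrow>bs. fps_const b * fps_X * fps_binomial (- 1)
               + C * fps_binomial (- 1) * (1 - fps_const b * q b))"
    unfolding daehee_hat_gf_def P_def q_def C_def
    by (rule fps_deriv_prod_list_binomial) (use daehee_hat_factor_deriv assms in blast)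
  \<comment> \<open>The first summands carry the same series as the term with
    \<open>fps_const x\<close>; by \<open>c\<close> they turn its coefficient x into
    \<open>x + sum_list bs\<close>.\<close>
  also have "P * fps_binomial x
        * (\<Sum>b\<leftarrow>bs. fps_const b * fps_X * fps_binomial (- 1)
             + C * fps_binomial (- 1) * (1 - fps_const b * q b))
      = (\<Sum>b\<leftarrow>bs. fps_const b * (fps_X * (P * fps_binomial (x - 1)))
           + C * (P * fps_binomial (x - 1))
           - fps_const b * (C * (P * q b * fps_binomial (x - 1))))"
    by (simp add: W algebra_simps flip: sum_list_const_mult)
  finally show ?thesis
    by (simp add: daehee_hat_gf_def P_def q_def C_def sum_list_subtractf sum_list_addf
        sum_list_triv c distrib_right mult.assoc flip: fps_const_add)
qed

lemma fact_mult_fps_mult_nth: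
  fixes f g :: "'a :: field_char_0 fps"
  shows "fact n * fps_nth (f * g) n
       = (\<Sum>l=0..n. of_nat (n choose l) * (fact l * fps_nth f l) * (fact (n - l) * fps_nth g (n - l)))"
  by (simp add: fps_mult_nth sum_distrib_left binomial_fact)

text \<open>Coefficient comparison for both kinds at once: K stands for the Cauchy series, H for the
  generating function at x - 1, and \<open>M j\<close> for the one with the j-th parameter
  repeated.\<close>

lemma fps_deriv_recurrence_nth:
  fixes G H K :: "'a :: field_char_0 fps"
  assumes "fps_X * fps_deriv G = fps_const c * fps_X * H + of_nat r * (K * H)
             - (\<Sum>j<r. fps_const (a j) * (K * M j))"
    and "n \<ge> 1"
  shows "fact n * fps_nth G n = c * (fact (n - 1) * fps_nth H (n - 1))
      + of_nat r / of_nat n * (fact n * fps_nth (K * H) n)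
      - 1 / of_nat n * (\<Sum>j<r. a j * (fact n * fps_nth (K * M j) n))"
proof -
  have n: "of_nat n \<noteq> (0 :: 'a)" "fact n = of_nat n * (fact (n - 1) :: 'a)"
    using \<open>n \<ge> 1\<close> by (auto simp: fact_reduce)
  have "of_nat n * fps_nth G n = fps_nth (fps_X * fps_deriv G) n"
    using \<open>n \<ge> 1\<close> by (simp add: fps_mult_fps_X_commute)
  also have "\<dots> = c * fps_nth H (n - 1) + of_nat r * fps_nth (K * H) n - (\<Sum>j<r. a j * fps_nth (K * M j) n)"
    using \<open>n \<ge> 1\<close> unfolding assms(1)
    by (simp add: mult.assoc fps_sum_nth flip: fps_of_nat)
  \<comment> \<open>Scaling by (n - 1)! turns n into n! on the left and suits the coefficient of H
    at n - 1; on the convolution terms (n - 1)! = n! / n produces the prefactors 1 / n.\<close>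
  finally have "fact (n - 1) * (of_nat n * fps_nth G n) = fact (n - 1) *
      (c * fps_nth H (n - 1) + of_nat r * fps_nth (K * H) n - (\<Sum>j<r. a j * fps_nth (K * M j) n))"
    by simp
  then show ?thesis
    using n by (simp add: sum_distrib_left algebra_simps)
qed

theorem theorem6:
  fixes r n :: nat and a :: "complex list" and x :: complex
  assumes "r \<ge> 1" and "length a = r" and "\<And>j. j < r \<Longrightarrow> a ! j \<noteq> 0" and "n \<ge> 1"
  shows
    "daehee n x a =
         x * daehee (n - 1) (x - 1) a
         + of_nat r / of_nat n *
             (\<Sum>l=0..n. of_nat (n choose l) * cauchy_num l * daehee (n - l) (x - 1) a)
         - 1 / of_nat n *
             (\<Sum>j<r. \<Sum>l=0..n. of_nat (n choose l) * a ! j * cauchy_num l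
                * daehee (n - l) (x + a ! j - 1) (a @ [a ! j]))
     \<and> daehee_hat n x a =
         (x + (\<Sum>j<r. a ! j)) * daehee_hat (n - 1) (x - 1) a
         + of_nat r / of_nat n *
             (\<Sum>l=0..n. of_nat (n choose l) * cauchy_num l * daehee_hat (n - l) (x - 1) a)
         - 1 / of_nat n *
             (\<Sum>j<r. \<Sum>l=0..n. of_nat (n choose l) * a ! j * cauchy_num l
                * daehee_hat (n - l) (x - 1) (a @ [a ! j]))"
proof -
  have nz: "b \<noteq> 0" if "b \<in> set a" for b
    using that assms(2,3) by (auto simp: in_set_conv_nth)
  \<comment> \<open>The result type of \<open>h\<close> is left general because the conversion is
    applied to sums of series and, in \<open>sl'\<close>, to sums of numbers.\<close>
  have sl: "(\<Sum>b\<leftarrow>a. h b) = (\<Sum>j<r. h (a ! j))" for h :: "complex \<Rightarrow> 'b :: comm_monoid_add"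
    using assms(2) by (simp add: sum_list_sum_nth atLeast0LessThan)
  have sl': "sum_list a = (\<Sum>j<r. a ! j)"
    using sl[of "\<lambda>b. b"] by simp
  have gf: "fps_X * fps_deriv (daehee_gf x a)
       = fps_const x * fps_X * daehee_gf (x - 1) a
         + of_nat r * (fps_X / fps_ln 1 * daehee_gf (x - 1) a)
         - (\<Sum>j<r. fps_const (a ! j)
             * (fps_X / fps_ln 1 * daehee_gf (x + a ! j - 1) (a @ [a ! j])))"
    using daehee_gf_deriv[of a x, OF nz] assms(2) by (simp add: sl)
  have hat_gf: "fps_X * fps_deriv (daehee_hat_gf x a)
       = fps_const (x + (\<Sum>j<r. a ! j)) * fps_X * daehee_hat_gf (x - 1) a
         + of_nat r * (fps_X / fps_ln 1 * daehee_hat_gf (x - 1) a)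
         - (\<Sum>j<r. fps_const (a ! j)
             * (fps_X / fps_ln 1 * daehee_hat_gf (x - 1) (a @ [a ! j])))"
    using daehee_hat_gf_deriv[of a x, OF nz] assms(2) by (simp only: sl sl')
  have conv: "fact n * fps_nth (fps_X / fps_ln 1 * g) n
      = (\<Sum>l=0..n. of_nat (n choose l) * cauchy_num l * (fact (n - l) * fps_nth g (n - l)))"
    for g :: "complex fps"
    unfolding fact_mult_fps_mult_nth cauchy_num_def ..
  show ?thesis
    using fps_deriv_recurrence_nth[OF gf assms(4)] fps_deriv_recurrence_nth[OF hat_gf assms(4)]
    unfolding conv daehee_def[symmetric] daehee_hat_def[symmetric]
    by (simp add: sum_distrib_left mult_ac)
qed

end
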